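(* For any dominant integral weight $\lambda$, there exists a $\lambda$-chain.
   Context: Root system. Let $V$ be a finite-dimensional real vector space with a nondegenerate symmetric bilinear form $\langle\cdot,\cdot\rangle$, and let $\Phi\subset V$ be the set of real roots of a complex symmetrizable Kac-Moody algebra, with simple roots $\alpha_1,\ldots,\alpha_r$. Put $\alpha^\vee=2\alpha/\langle\alpha,\alpha\rangle$ for $\alpha\in\Phi$ and $s_\alpha(v)=v-\langle v,\alpha^\vee\rangle\alpha$; let $W\subset GL(V)$ be the Weyl group generated by the $s_\alpha$, $\alpha\in\Phi$. Thus: $\alpha_1,\dots,\alpha_r$ are linearly independent; $\langle\alpha_p,\alpha_p\rangle>0$; $\langle\alpha_p,\alpha_q^\vee\rangle\in\mathbb{Z}_{\le0}$ for $p\ne q$; and $\Phi=\bigcup_p W\alpha_p$. $\Phi^+$ is the set of roots in the nonnegative span of the simple roots, and $\Phi=\Phi^+\sqcup(-\Phi^+)$. The integral weights are $\Lambda=\{v\in V\mid\langle v,\alpha_p^\vee\rangle\in\mathbb{Z},\ p=1,\dots,r\}$; a weight $\lambda\in\Lambda$ is dominant if $\langle\lambda,\alpha^\vee\rangle\ge0$ for all $\alpha\in\Phi^+$. $\lambda$-chains. A $\lambda$-chain is a family $\{\beta_i\}_{i\in I}$ of positive roots indexed by a totally ordered set $I$ such that: (1) for each $\alpha\in\Phi^+$, $\#\{i\in I\mid\beta_i=\alpha\}=\langle\lambda,\alpha^\vee\rangle$; (2) for any roots $\alpha,\beta,\gamma\in\Phi$ with $\alpha\ne\pm\beta$ and $\gamma^\vee=\alpha^\vee+k\beta^\vee$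 for some integer $k$, and any $i\in I$ with $\beta_i=\beta$, one has $N_i(\gamma)=N_i(\alpha)+kN_i(\beta)$. Here, for $\alpha\in\Phi^+$, $N_i(\alpha)=\#\{j<i\mid\beta_j=\alpha\}$ and $N_i(-\alpha)=1-N_i(\alpha)$. *)

theory Defs
  imports "HOL-Analysis.Analysis" "HOL-Algebra.Bij" "HOL-Algebra.Generated_Groups"
begin

text \<open>
  Throughout, \<open>B\<close> is the bilinear form on \<open>V\<close> (the whole type), and the simple roots are the
  family \<open>\<alpha> 1, \<dots>, \<alpha> r\<close>; values of \<open>\<alpha>\<close> outside \<open>{1..r}\<close> are irrelevant.
\<close>

definition coroot :: "('v::real_vector \<Rightarrow> 'v \<Rightarrow> real) \<Rightarrow> 'v \<Rightarrow> 'v" where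
  "coroot B \<beta> = (2 / B \<beta> \<beta>) *\<^sub>R \<beta>"

definition reflection :: "('v::real_vector \<Rightarrow> 'v \<Rightarrow> real) \<Rightarrow> 'v \<Rightarrow> 'v \<Rightarrow> 'v" where
  "reflection B \<beta> v = v - B v (coroot B \<beta>) *\<^sub>R \<beta>"

text \<open>
  Since the real roots are the Weyl group orbits of the simple roots, the Weyl group is generated
  here by the simple reflections; \<open>weyl_group_eq_generate_roots\<close> below shows that this is the group
  generated by the reflections in all real roots.
\<close>

definition weyl_group ::
  "('v::real_vector \<Rightarrow> 'v \<Rightarrow> real) \<Rightarrow> (nat \<Rightarrow> 'v) \<Rightarrow> nat \<Rightarrow> ('v \<Rightarrow> 'v) set" where
  "weyl_group B \<alpha> r = generate (BijGroup UNIV) ((\<lambda>p. reflection B (\<alpha> p)) ` {1..r})"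

definition real_roots ::
  "('v::real_vector \<Rightarrow> 'v \<Rightarrow> real) \<Rightarrow> (nat \<Rightarrow> 'v) \<Rightarrow> nat \<Rightarrow> 'v set" where
  "real_roots B \<alpha> r = (\<Union>p\<in>{1..r}. {w (\<alpha> p) |w. w \<in> weyl_group B \<alpha> r})"

definition positive_roots ::
  "('v::real_vector \<Rightarrow> 'v \<Rightarrow> real) \<Rightarrow> (nat \<Rightarrow> 'v) \<Rightarrow> nat \<Rightarrow> 'v set" where
  "positive_roots B \<alpha> r =
     {\<beta> \<in> real_roots B \<alpha> r. \<exists>c. (\<forall>p\<in>{1..r}. 0 \<le> c p) \<and> \<beta> = (\<Sum>p=1..r. c p *\<^sub>R \<alpha> p)}"

text \<open>
  The last two assumptions are the decomposition of the real roots into positive and negative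
  roots, a standard fact about Kac-Moody root systems which is part of the standing data.
\<close>

locale kac_moody_roots =
  fixes B :: "'v::real_vector \<Rightarrow> 'v \<Rightarrow> real" and \<alpha> :: "nat \<Rightarrow> 'v" and r :: nat
  assumes finite_dim: "\<exists>S::'v set. finite S \<and> span S = UNIV"
    and bilinear: "bilinear B"
    and symmetric: "B x y = B y x"
    and nondegenerate: "(\<And>y. B x y = 0) \<Longrightarrow> x = 0"
    and simple_inj: "inj_on \<alpha> {1..r}"
    and simple_independent: "Real_Vector_Spaces.independent (\<alpha> ` {1..r})"
    and simple_norm_pos: "p \<in> {1..r} \<Longrightarrow> 0 < B (\<alpha> p) (\<alpha> p)"
    and cartan_int: "\<lbrakk>p \<in> {1..r}; q \<in> {1..r}; p \<noteq> q\<rbrakk> \<Longrightarrow> B (\<alpha> p) (coroot B (\<alpha> q)) \<in> \<int>"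
    and cartan_nonpos: "\<lbrakk>p \<in> {1..r}; q \<in> {1..r}; p \<noteq> q\<rbrakk> \<Longrightarrow> B (\<alpha> p) (coroot B (\<alpha> q)) \<le> 0"
    and roots_pos_neg: "real_roots B \<alpha> r = positive_roots B \<alpha> r \<union> uminus ` positive_roots B \<alpha> r"
    and pos_neg_disjoint: "positive_roots B \<alpha> r \<inter> uminus ` positive_roots B \<alpha> r = {}"

definition integral_weights ::
  "('v::real_vector \<Rightarrow> 'v \<Rightarrow> real) \<Rightarrow> (nat \<Rightarrow> 'v) \<Rightarrow> nat \<Rightarrow> 'v set" where
  "integral_weights B \<alpha> r = {v. \<forall>p\<in>{1..r}. B v (coroot B (\<alpha> p)) \<in> \<int>}"

definition dominant ::
  "('v::real_vector \<Rightarrow> 'v \<Rightarrow> real) \<Rightarrow> (nat \<Rightarrow> 'v) \<Rightarrow> nat \<Rightarrow> 'v \<Rightarrow> bool" where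
  "dominant B \<alpha> r \<mu> \<longleftrightarrow> (\<forall>\<gamma>\<in>positive_roots B \<alpha> r. 0 \<le> B \<mu> (coroot B \<gamma>))"

text \<open>
  The number \<open>N\<^sub>i(\<gamma>)\<close>, for a family \<open>\<beta>\<close> indexed by a set \<open>I\<close> with (reflexive) order relation
  \<open>R\<close>; the second branch is \<open>N\<^sub>i(-\<gamma>') = 1 - N\<^sub>i(\<gamma>')\<close> with \<open>\<gamma>' = -\<gamma>\<close> positive.
\<close>

definition chain_count ::
  "('v::real_vector \<Rightarrow> 'v \<Rightarrow> real) \<Rightarrow> (nat \<Rightarrow> 'v) \<Rightarrow> nat \<Rightarrow>
   'i set \<Rightarrow> 'i rel \<Rightarrow> ('i \<Rightarrow> 'v) \<Rightarrow> 'i \<Rightarrow> 'v \<Rightarrow> int" where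
  "chain_count B \<alpha> r I R \<beta> i \<gamma> =
     (if \<gamma> \<in> positive_roots B \<alpha> r
      then int (card {j \<in> I. (j, i) \<in> R \<and> j \<noteq> i \<and> \<beta> j = \<gamma>})
      else 1 - int (card {j \<in> I. (j, i) \<in> R \<and> j \<noteq> i \<and> \<beta> j = - \<gamma>}))"

text \<open>
  Because \<open>card\<close> of an infinite set is \<open>0\<close>, finiteness in the multiplicity condition is explicit;
  it also makes every set counted by \<open>chain_count\<close> finite.
\<close>

definition lambda_chain ::
  "('v::real_vector \<Rightarrow> 'v \<Rightarrow> real) \<Rightarrow> (nat \<Rightarrow> 'v) \<Rightarrow> nat \<Rightarrow> 'v \<Rightarrow>
   'i set \<Rightarrow> 'i rel \<Rightarrow> ('i \<Rightarrow> 'v) \<Rightarrow> bool" where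
  "lambda_chain B \<alpha> r \<mu> I R \<beta> \<longleftrightarrow>
     linear_order_on I R \<and>
     \<beta> ` I \<subseteq> positive_roots B \<alpha> r \<and>
     (\<forall>\<gamma>\<in>positive_roots B \<alpha> r.
        finite {i \<in> I. \<beta> i = \<gamma>} \<and> real (card {i \<in> I. \<beta> i = \<gamma>}) = B \<mu> (coroot B \<gamma>)) \<and>
     (\<forall>\<gamma>\<^sub>1\<in>real_roots B \<alpha> r. \<forall>\<gamma>\<^sub>2\<in>real_roots B \<alpha> r. \<forall>\<gamma>\<^sub>3\<in>real_roots B \<alpha> r. \<forall>k::int. \<forall>i\<in>I.
        \<gamma>\<^sub>1 \<noteq> \<gamma>\<^sub>2 \<longrightarrow> \<gamma>\<^sub>1 \<noteq> - \<gamma>\<^sub>2 \<longrightarrow>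
        coroot B \<gamma>\<^sub>3 = coroot B \<gamma>\<^sub>1 + of_int k *\<^sub>R coroot B \<gamma>\<^sub>2 \<longrightarrow>
        \<beta> i = \<gamma>\<^sub>2 \<longrightarrow>
        chain_count B \<alpha> r I R \<beta> i \<gamma>\<^sub>3 =
          chain_count B \<alpha> r I R \<beta> i \<gamma>\<^sub>1 + k * chain_count B \<alpha> r I R \<beta> i \<gamma>\<^sub>2)"

context kac_moody_roots
begin

abbreviation "isometry w \<equiv> bij w \<and> linear w \<and> (\<forall>x y. B (w x) (w y) = B x y)"

lemma reflection_involution:
  assumes "B \<beta> \<beta> \<noteq> 0"
  shows "reflection B \<beta> (reflection B \<beta> v) = v"
  using assms bilinear
  by (simp add: reflection_def coroot_def bilinear_lsub bilinear_lmul bilinear_rmul algebra_simps)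

lemma isometry_reflection:
  assumes "B \<beta> \<beta> \<noteq> 0"
  shows "isometry (reflection B \<beta>)"
proof (intro conjI allI)
  show "bij (reflection B \<beta>)"
    by (rule o_bij[of "reflection B \<beta>"]) (use reflection_involution[OF assms] in auto)
  show "linear (reflection B \<beta>)"
    using bilinear
    by (intro linearI)
       (simp_all add: reflection_def coroot_def bilinear_ladd bilinear_lmul bilinear_rmul algebra_simps)
  show "B (reflection B \<beta> x) (reflection B \<beta> y) = B x y" for x y
    using assms bilinear symmetric[of y \<beta>]
    by (simp add: reflection_def coroot_def bilinear_lsub bilinear_rsub bilinear_lmul bilinear_rmul
        field_simps)
qed

lemma BijGroup_UNIV:
  "carrier (BijGroup UNIV) = {f::'v \<Rightarrow> 'v. bij f}" "\<one>\<^bsub>BijGroup UNIV\<^esub> = (id :: 'v \<Rightarrow> 'v)"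
  "bij f \<Longrightarrow> bij g \<Longrightarrow> f \<otimes>\<^bsub>BijGroup UNIV\<^esub> g = f \<circ> (g :: 'v \<Rightarrow> 'v)"
  by (auto simp: BijGroup_def Bij_def extensional_def compose_def fun_eq_iff)

lemma inv_BijGroup_reflection:
  assumes "B \<beta> \<beta> \<noteq> 0"
  shows "inv\<^bsub>BijGroup UNIV\<^esub> (reflection B \<beta>) = reflection B \<beta>"
proof -
  interpret group "BijGroup (UNIV :: 'v set)" by (rule group_BijGroup)
  show ?thesis
    using isometry_reflection[OF assms] reflection_involution[OF assms]
    by (intro inv_equality) (auto simp: BijGroup_UNIV)
qed

lemma isometry_generate:
  assumes "w \<in> generate (BijGroup UNIV) (reflection B ` S)" "\<And>\<beta>. \<beta> \<in> S \<Longrightarrow> B \<beta> \<beta> \<noteq> 0"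
  shows "isometry w"
  using assms(1)
proof induction
  case one
  then show ?case using bij_id by (simp add: BijGroup_UNIV linear_iff id_def)
next
  case (incl h)
  then show ?case using isometry_reflection assms(2) by auto
next
  case (inv h)
  then show ?case using isometry_reflection inv_BijGroup_reflection assms(2) by auto
next
  case (eng w1 w2)
  then show ?case
    using bij_comp[of w2 w1] linear_compose[of w2 w1] by (simp add: BijGroup_UNIV o_def)
qed

lemma weyl_group_generate: "weyl_group B \<alpha> r = generate (BijGroup UNIV) (reflection B ` \<alpha> ` {1..r})"
  by (simp add: weyl_group_def image_image)

lemma weyl_isometry: "w \<in> weyl_group B \<alpha> r \<Longrightarrow> isometry w"
  unfolding weyl_group_generate by (rule isometry_generate) (use simple_norm_pos in fastforce)+

lemma root_norm_pos:
  assumes "\<beta> \<in> real_roots B \<alpha> r" shows "0 < B \<beta> \<beta>"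
  using assms weyl_isometry simple_norm_pos unfolding real_roots_def by force

theorem weyl_group_eq_generate_roots:
  "weyl_group B \<alpha> r = generate (BijGroup UNIV) (reflection B ` real_roots B \<alpha> r)"
proof
  interpret group "BijGroup (UNIV :: 'v set)" by (rule group_BijGroup)
  have sub: "subgroup (weyl_group B \<alpha> r) (BijGroup UNIV)"
    unfolding weyl_group_generate
    by (rule generate_is_subgroup)
       (use simple_norm_pos isometry_reflection in \<open>force simp: BijGroup_UNIV\<close>)
  have "id \<in> weyl_group B \<alpha> r"
    using subgroup.one_closed[OF sub] by (simp add: BijGroup_UNIV)
  then have "\<alpha> ` {1..r} \<subseteq> real_roots B \<alpha> r"
    unfolding real_roots_def by (fastforce intro: exI[of _ id])
  then show "weyl_group B \<alpha> r \<subseteq> generate (BijGroup UNIV) (reflection B ` real_roots B \<alpha> r)"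
    unfolding weyl_group_generate by (intro mono_generate image_mono)
  have "reflection B \<beta> \<in> weyl_group B \<alpha> r" if root: "\<beta> \<in> real_roots B \<alpha> r" for \<beta>
  proof -
    obtain w p where w: "w \<in> weyl_group B \<alpha> r" and p: "p \<in> {1..r}" and \<beta>: "\<beta> = w (\<alpha> p)"
      using root unfolding real_roots_def by blast
    have iso: "isometry w" and lin: "linear w"
      using weyl_isometry[OF w] by auto
    have s: "reflection B (\<alpha> p) \<in> weyl_group B \<alpha> r"
      unfolding weyl_group_def using p by (auto intro: generate.incl)
    have bs: "bij (reflection B (\<alpha> p))"
      using weyl_isometry[OF s] by blast
    have "reflection B \<beta> \<otimes>\<^bsub>BijGroup UNIV\<^esub> w = w \<otimes>\<^bsub>BijGroup UNIV\<^esub> reflection B (\<alpha> p)"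
    proof -
      have "bij (reflection B \<beta>)"
        using isometry_reflection root_norm_pos[OF root] by force
      moreover have "reflection B \<beta> (w x) = w (reflection B (\<alpha> p) x)" for x
        using iso bilinear
        by (simp add: \<beta> reflection_def coroot_def linear_diff linear_scale[OF lin] bilinear_rmul)
      ultimately show ?thesis
        using iso bs by (auto simp: BijGroup_UNIV)
    qed
    then have "reflection B \<beta> = w \<otimes>\<^bsub>BijGroup UNIV\<^esub> reflection B (\<alpha> p) \<otimes>\<^bsub>BijGroup UNIV\<^esub> inv\<^bsub>BijGroup UNIV\<^esub> w"
      using iso bs isometry_reflection[of \<beta>] root_norm_pos[OF root]
      by (intro inv_solve_right[THEN iffD2]) (auto simp: BijGroup_UNIV bij_comp)
    then show ?thesis
      using sub w s by (simp add: subgroup.m_closed subgroup.m_inv_closed)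
  qed
  then show "generate (BijGroup UNIV) (reflection B ` real_roots B \<alpha> r) \<subseteq> weyl_group B \<alpha> r"
    using sub by (intro generate_subgroup_incl) auto
qed

end

end

theory Submission
  imports Defs
begin

text \<open>
  Following Lenart and Postnikov, index the chain by the pairs \<open>(\<beta>, k)\<close> with
  \<open>0 \<le> k < \<langle>\<mu>, \<beta>\<^sup>\<or>\<rangle>\<close> and order them lexicographically by \<open>(k, \<beta>\<^sup>\<or>) / \<langle>\<mu>, \<beta>\<^sup>\<or>\<rangle>\<close>, where coroots
  are compared lexicographically in their simple coordinates.  Fix \<open>i = (\<beta>, m)\<close> and put
  \<open>b = \<langle>\<mu>, \<beta>\<^sup>\<or>\<rangle>\<close>, \<open>t = m / b\<close>.  For every root \<open>\<gamma> \<noteq> \<plusminus>\<beta>\<close>, positive or negative, the number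
  \<open>N\<^sub>i(\<gamma>)\<close> is \<open>\<lceil>a t\<rceil>\<close> with \<open>a = \<langle>\<mu>, \<gamma>\<^sup>\<or>\<rangle>\<close>, plus 1 if \<open>a t\<close> is an integer and
  \<open>a \<beta>\<^sup>\<or> - b \<gamma>\<^sup>\<or>\<close> is lexicographically positive.  Replacing \<open>\<gamma>\<^sup>\<or>\<close> by \<open>\<gamma>\<^sup>\<or> + k \<beta>\<^sup>\<or>\<close> does not change
  that vector and adds the integer \<open>k m\<close> to \<open>a t\<close>; as \<open>N\<^sub>i(\<beta>) = m\<close>, this is the second condition.
\<close>

section \<open>Counting natural numbers below a real threshold\<close>

text \<open>The set is an initial segment of the naturals, since \<open>t < 1\<close> keeps every
  \<open>k\<close> up to the threshold below \<open>a\<close> when \<open>a > 0\<close>. For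
  \<open>a = 0\<close> the set is empty while the threshold 0 is an integer, so the extra 1 must be
  excluded by hypothesis.\<close>

lemma card_nat_below:
  fixes a :: nat and t :: real
  assumes "0 \<le> t" "t < 1" "a = 0 \<Longrightarrow> \<not> Q"
  shows "int (card {k. k < a \<and> (real k < a * t \<or> real k = a * t \<and> Q)}) =
    \<lceil>a * t\<rceil> + (if a * t \<in> \<int> \<and> Q then 1 else 0)"
proof -
  define n where "n = \<lceil>a * t\<rceil> + (if a * t \<in> \<int> \<and> Q then 1 else 0)"
  have at: "0 \<le> a * t" "a > 0 \<Longrightarrow> a * t < a"
    using assms(1,2) by simp_all
  have n: "0 \<le> n"
    using at unfolding n_def by (simp add: le_ceiling_iff)
  have "k < a \<and> (real k < a * t \<or> real k = a * t \<and> Q) \<longleftrightarrow> int k < n" for k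
  proof (cases "a * t \<in> \<int>")
    case True
    then obtain z where z: "a * t = of_int z"
      by (auto elim: Ints_cases)
    have real_int: "real k < of_int z \<longleftrightarrow> int k < z" "real k = of_int z \<longleftrightarrow> int k = z"
      by linarith+
    have "n = z + (if Q then 1 else 0)"
      by (simp add: n_def z)
    moreover have "z < a \<or> z = 0 \<and> \<not> Q"
    proof (cases "a = 0")
      case False
      then have "of_int z < real a"
        using at(2) z by simp
      then show ?thesis by linarith
    qed (use z assms(3) in simp)
    ultimately show ?thesis
      unfolding z real_int by (cases Q) auto
  next
    case False
    then have "a > 0" "real k \<noteq> a * t"
      by (auto intro!: Nat.gr0I) (metis Ints_of_nat)
    moreover have "int k < \<lceil>a * t\<rceil> \<longleftrightarrow> real k < a * t"
      by (simp add: less_ceiling_iff)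
    moreover have "n = \<lceil>a * t\<rceil>"
      using False by (simp add: n_def)
    moreover have "real k < a" if "real k < a * t"
      using that at(2) \<open>a > 0\<close> by linarith
    ultimately show ?thesis
      by auto
  qed
  then have "{k. k < a \<and> (real k < a * t \<or> real k = a * t \<and> Q)} = {..<nat n}"
    by (simp add: lessThan_def zless_nat_eq_int_zless)
  then show ?thesis
    using n by (simp add: n_def)
qed

section \<open>Positive cones and the lexicographic order\<close>

text \<open>Read \<open>P v\<close> as \<open>v > 0\<close> in a partial order compatible with
  addition and positive scaling. Totality is added later, and only on the span of the simple
  roots.\<close>

locale positive_cone =
  fixes P :: "'v::real_vector \<Rightarrow> bool"
  assumes add: "P u \<Longrightarrow> P v \<Longrightarrow> P (u + v)"
    and scale: "0 < c \<Longrightarrow> P v \<Longrightarrow> P (c *\<^sub>R v)"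
    and nonzero: "\<not> P 0"
begin

lemma scale_iff: "0 < c \<Longrightarrow> P (c *\<^sub>R v) \<longleftrightarrow> P v"
  using scale[of c v] scale[of "inverse c" "c *\<^sub>R v"] by auto

lemma asym: "P v \<Longrightarrow> \<not> P (- v)"
  using add[of v "- v"] nonzero by auto

lemma nonneg_sum:
  assumes "\<And>p. p \<in> A \<Longrightarrow> P (g p)" "\<And>p. p \<in> A \<Longrightarrow> 0 \<le> c p"
  shows "(\<Sum>p\<in>A. c p *\<^sub>R g p) = 0 \<or> P (\<Sum>p\<in>A. c p *\<^sub>R g p)"
  using assms
proof (induction A rule: infinite_finite_induct)
  case (insert p A)
  have "c p *\<^sub>R g p = 0 \<or> P (c p *\<^sub>R g p)"
    using insert.prems by (cases "c p = 0") (auto intro: scale simp: less_le)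
  then show ?case
    using insert by (auto intro: add)
qed auto

end

text \<open>Linear extension from an independent set; injectivity turns the indicator of the vector
  \<open>\<alpha> p\<close> into that of the index \<open>p\<close>. Outside \<open>A\<close> only
  linearity is asked, so that one choice over all indices yields the family.\<close>

lemma ex_dual_functionals:
  fixes \<alpha> :: "'i \<Rightarrow> 'v::real_vector"
  assumes "independent (\<alpha> ` A)" "inj_on \<alpha> A"
  shows "\<exists>f::'i \<Rightarrow> 'v \<Rightarrow> real.
    \<forall>p. linear (f p) \<and> (p \<in> A \<longrightarrow> (\<forall>q\<in>A. f p (\<alpha> q) = (if q = p then 1 else 0)))"
proof (rule choice, rule allI)
  fix p
  obtain g :: "'v \<Rightarrow> real" where "linear g" "\<forall>x\<in>\<alpha> ` A. g x = (if x = \<alpha> p then 1 else 0)"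
    using linear_independent_extend[OF assms(1), of "\<lambda>x. if x = \<alpha> p then 1 else 0"] by auto
  then show "\<exists>g::'v \<Rightarrow> real. linear g \<and> (p \<in> A \<longrightarrow> (\<forall>q\<in>A. g (\<alpha> q) = (if q = p then 1 else 0)))"
    using assms(2) by (intro exI[of _ g]) (auto dest: inj_onD)
qed

text \<open>A vector is positive if its first nonzero simple coordinate is positive. A nonzero
  vector of the span has such a coordinate, and its sign decides between \<open>v\<close> and
  \<open>- v\<close>.\<close>

lemma ex_lex_cone:
  fixes \<alpha> :: "nat \<Rightarrow> 'v::real_vector"
  assumes "independent (\<alpha> ` {1..r})" "inj_on \<alpha> {1..r}"
  obtains P where "positive_cone P" "\<And>p. p \<in> {1..r} \<Longrightarrow> P (\<alpha> p)"
    "\<And>v. v \<in> span (\<alpha> ` {1..r}) \<Longrightarrow> v \<noteq> 0 \<Longrightarrow> P v \<or> P (- v)"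
proof -
  obtain f :: "nat \<Rightarrow> 'v \<Rightarrow> real" where lin: "\<And>p. linear (f p)"
    and dual: "\<And>p q. p \<in> {1..r} \<Longrightarrow> q \<in> {1..r} \<Longrightarrow> f p (\<alpha> q) = (if q = p then 1 else 0)"
    using ex_dual_functionals[OF assms] by metis
  define P where "P v \<longleftrightarrow> (\<exists>p\<in>{1..r}. 0 < f p v \<and> (\<forall>q\<in>{1..<p}. f q v = 0))" for v
  show thesis
  proof
    show "positive_cone P"
    proof
      fix u v assume "P u" "P v"
      then obtain p q where
        pq: "p \<in> {1..r}" "0 < f p u" "\<forall>s\<in>{1..<p}. f s u = 0"
          "q \<in> {1..r}" "0 < f q v" "\<forall>s\<in>{1..<q}. f s v = 0"
        unfolding P_def by blast
      \<comment> \<open>At the smaller of the two leading indices one coordinate is positive and the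
        other is positive or zero.\<close>
      have "0 < f (min p q) u + f (min p q) v"
        using pq by (cases p q rule: linorder_cases) (auto simp: min_def)
      then show "P (u + v)"
        unfolding P_def using pq
        by (intro bexI[of _ "min p q"]) (auto simp: linear_add[OF lin] min_def)
    next
      fix c :: real and v assume "0 < c" "P v"
      then obtain p where "p \<in> {1..r}" "0 < f p v" "\<forall>q\<in>{1..<p}. f q v = 0"
        unfolding P_def by blast
      with \<open>0 < c\<close> show "P (c *\<^sub>R v)"
        unfolding P_def by (intro bexI[of _ p]) (auto simp: linear_scale[OF lin])
    next
      show "\<not> P 0"
        unfolding P_def by (auto simp: linear_0[OF lin])
    qed
    show "P (\<alpha> p)" if "p \<in> {1..r}" for p
      unfolding P_def using that by (intro bexI[of _ p]) (auto simp: dual)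
    show "P v \<or> P (- v)" if v: "v \<in> span (\<alpha> ` {1..r})" "v \<noteq> 0" for v
    proof -
      obtain c where "v = (\<Sum>x\<in>\<alpha> ` {1..r}. c x *\<^sub>R x)"
        using v(1) span_finite[of "\<alpha> ` {1..r}"] by auto
      then have vc: "v = (\<Sum>p\<in>{1..r}. c (\<alpha> p) *\<^sub>R \<alpha> p)"
        by (subst (asm) sum.reindex[OF assms(2)]) simp
      have "f p v = c (\<alpha> p)" if "p \<in> {1..r}" for p
        using that by (simp add: vc linear_sum[OF lin] linear_scale[OF lin] dual if_distrib cong: if_cong)
      then have "\<exists>p. p \<in> {1..r} \<and> f p v \<noteq> 0"
        using v(2) vc by (metis (no_types, lifting) scaleR_zero_left sum.neutral)
      then obtain p where p: "p \<in> {1..r}" "f p v \<noteq> 0" "\<And>q. q < p \<Longrightarrow> \<not> (q \<in> {1..r} \<and> f q v \<noteq> 0)"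
        using exists_least_iff[of "\<lambda>p. p \<in> {1..r} \<and> f p v \<noteq> 0"] by blast
      then have "\<forall>q\<in>{1..<p}. f q v = 0"
        by auto
      with p show ?thesis
        unfolding P_def by (auto simp: linear_neg[OF lin] neq_iff)
    qed
  qed
qed

section \<open>The coroot lattice and proportional coroots\<close>

context kac_moody_roots
begin

text \<open>This Weyl-stable lattice serves two ends: integrality of the pairings with \<mu>, and
  the fact that proportional coroots agree up to sign.\<close>

definition coroot_lattice :: "'v set" where
  "coroot_lattice = {\<Sum>p=1..r. of_int (n p) *\<^sub>R coroot B (\<alpha> p) |n. True}"

lemma coroot_latticeI: "v = (\<Sum>p=1..r. of_int (n p) *\<^sub>R coroot B (\<alpha> p)) \<Longrightarrow> v \<in> coroot_lattice"
  unfolding coroot_lattice_def by blast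

lemma coroot_latticeE:
  assumes "v \<in> coroot_lattice"
  obtains n where "v = (\<Sum>p=1..r. of_int (n p) *\<^sub>R coroot B (\<alpha> p))"
  using assms unfolding coroot_lattice_def by blast

lemma scale_coroot_simple_in_lattice:
  assumes "q \<in> {1..r}" shows "of_int z *\<^sub>R coroot B (\<alpha> q) \<in> coroot_lattice"
  using assms
  by (intro coroot_latticeI[of _ "\<lambda>p. if p = q then z else 0"])
     (simp add: if_distrib[of "\<lambda>x. x *\<^sub>R _"] if_distrib[of of_int] cong: if_cong)

lemma coroot_lattice_diff:
  assumes "u \<in> coroot_lattice" "v \<in> coroot_lattice" shows "u - v \<in> coroot_lattice"
proof -
  obtain m n where "u = (\<Sum>p=1..r. of_int (m p) *\<^sub>R coroot B (\<alpha> p))"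
    "v = (\<Sum>p=1..r. of_int (n p) *\<^sub>R coroot B (\<alpha> p))"
    using assms by (auto elim!: coroot_latticeE)
  then show ?thesis
    by (intro coroot_latticeI[of _ "\<lambda>p. m p - n p"]) (simp add: scaleR_diff_left sum_subtractf)
qed

text \<open>The vector \<open>x\<close> is arbitrary because both simple roots and the weight \<mu>
  are substituted for it.\<close>

lemma B_coroot_lattice_Ints:
  assumes "v \<in> coroot_lattice" "\<And>p. p \<in> {1..r} \<Longrightarrow> B x (coroot B (\<alpha> p)) \<in> \<int>"
  shows "B x v \<in> \<int>"
proof -
  obtain n where n: "v = (\<Sum>p=1..r. of_int (n p) *\<^sub>R coroot B (\<alpha> p))"
    using assms(1) by (rule coroot_latticeE)
  have lin: "linear (B x)"
    using bilinear by (simp add: bilinear_def)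
  show ?thesis
    using assms(2) by (auto simp: n linear_sum[OF lin] linear_scale[OF lin] intro!: Ints_sum Ints_mult)
qed

lemma simple_coroot_Ints:
  assumes "p \<in> {1..r}" "q \<in> {1..r}" shows "B (\<alpha> p) (coroot B (\<alpha> q)) \<in> \<int>"
proof (cases "p = q")
  case True
  then show ?thesis
    using simple_norm_pos[OF assms(2)] bilinear by (simp add: coroot_def bilinear_rmul)
qed (use assms cartan_int in auto)

lemma reflection_lattice:
  assumes q: "q \<in> {1..r}" and v: "v \<in> coroot_lattice"
  shows "reflection B (\<alpha> q) v \<in> coroot_lattice"
proof -
  have "B (\<alpha> q) v \<in> \<int>"
    using B_coroot_lattice_Ints[OF v] simple_coroot_Ints q by blast
  then obtain z where z: "B (\<alpha> q) v = of_int z"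
    by (auto elim: Ints_cases)
  \<comment> \<open>The normalizing factor of the coroot moves from inside the form to the root
    outside, which leaves an integer multiple of a simple coroot.\<close>
  have "reflection B (\<alpha> q) v = v - of_int z *\<^sub>R coroot B (\<alpha> q)"
    using z symmetric[of v "\<alpha> q"] bilinear by (simp add: reflection_def coroot_def bilinear_rmul)
  then show ?thesis
    using coroot_lattice_diff[OF v] scale_coroot_simple_in_lattice[OF q] by simp
qed

lemma reflection_lattice_iff:
  assumes "q \<in> {1..r}"
  shows "reflection B (\<alpha> q) v \<in> coroot_lattice \<longleftrightarrow> v \<in> coroot_lattice"
proof -
  have "reflection B (\<alpha> q) (reflection B (\<alpha> q) v) = v"
    using simple_norm_pos[OF assms] by (intro reflection_involution) simp
  then show ?thesis
    using reflection_lattice[OF assms, of v] reflection_lattice[OF assms, of "reflection B (\<alpha> q) v"]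
    by auto
qed

text \<open>As an equivalence this also pulls membership back along \<open>w\<close>, without
  mention of its inverse.\<close>

lemma weyl_lattice_iff:
  assumes "w \<in> weyl_group B \<alpha> r"
  shows "w v \<in> coroot_lattice \<longleftrightarrow> v \<in> coroot_lattice"
  using assms unfolding weyl_group_generate
proof (induction arbitrary: v)
  case one
  then show ?case by (simp add: BijGroup_UNIV)
next
  case (incl h)
  then show ?case
    using reflection_lattice_iff by blast
next
  case (inv h)
  then obtain q where q: "q \<in> {1..r}" "h = reflection B (\<alpha> q)" by blast
  then have "inv\<^bsub>BijGroup UNIV\<^esub> h = h"
    using simple_norm_pos[of q] inv_BijGroup_reflection[of "\<alpha> q"] by simp
  then show ?case
    using q reflection_lattice_iff by simp
next
  case (eng w1 w2)
  then have "bij w1" "bij w2"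
    using weyl_isometry unfolding weyl_group_generate by blast+
  with eng.IH show ?case
    by (simp add: BijGroup_UNIV)
qed

lemma coroot_weyl:
  assumes "w \<in> weyl_group B \<alpha> r" shows "coroot B (w v) = w (coroot B v)"
  using weyl_isometry[OF assms] by (simp add: coroot_def linear_scale)

lemma coroot_in_lattice:
  assumes "\<beta> \<in> real_roots B \<alpha> r" shows "coroot B \<beta> \<in> coroot_lattice"
proof -
  obtain w p where "w \<in> weyl_group B \<alpha> r" "p \<in> {1..r}" "\<beta> = w (\<alpha> p)"
    using assms unfolding real_roots_def by blast
  then show ?thesis
    using scale_coroot_simple_in_lattice[of p 1] by (simp add: coroot_weyl weyl_lattice_iff)
qed

text \<open>Coroots are primitive in the lattice: a Weyl group element moves the coroot to a simple
  one, a member of a lattice basis, and the coordinate at that simple root gives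
  \<open>c\<close>.\<close>

lemma scale_coroot_in_lattice_imp_Ints:
  assumes \<beta>: "\<beta> \<in> real_roots B \<alpha> r" and c: "c *\<^sub>R coroot B \<beta> \<in> coroot_lattice"
  shows "c \<in> \<int>"
proof -
  obtain w p where w: "w \<in> weyl_group B \<alpha> r" and p: "p \<in> {1..r}" and "\<beta> = w (\<alpha> p)"
    using \<beta> unfolding real_roots_def by blast
  then have "w (c *\<^sub>R coroot B (\<alpha> p)) \<in> coroot_lattice"
    using c weyl_isometry[OF w] by (simp add: coroot_weyl linear_scale)
  then have "c *\<^sub>R coroot B (\<alpha> p) \<in> coroot_lattice"
    using weyl_lattice_iff[OF w] by blast
  then obtain n where n: "c *\<^sub>R coroot B (\<alpha> p) = (\<Sum>q=1..r. of_int (n q) *\<^sub>R coroot B (\<alpha> q))"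
    by (rule coroot_latticeE)
  obtain f :: "'v \<Rightarrow> real" where lin: "linear f"
    and f: "\<And>q. q \<in> {1..r} \<Longrightarrow> f (\<alpha> q) = (if q = p then 1 else 0)"
    using ex_dual_functionals[OF simple_independent simple_inj] p by metis
  have "f (c *\<^sub>R coroot B (\<alpha> p)) = (\<Sum>q=1..r. of_int (n q) * f (coroot B (\<alpha> q)))"
    unfolding n by (simp add: linear_sum[OF lin] linear_scale[OF lin])
  also have "\<dots> = of_int (n p) * (2 / B (\<alpha> p) (\<alpha> p))"
    using p by (simp add: coroot_def linear_scale[OF lin] f if_distrib cong: if_cong)
  finally have "c = of_int (n p)"
    using simple_norm_pos[OF p] p by (simp add: coroot_def linear_scale[OF lin] f)
  then show ?thesis by simp
qed

lemma coroot_uminus: "coroot B (- \<beta>) = - coroot B \<beta>"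
  using bilinear by (simp add: coroot_def bilinear_lneg bilinear_rneg)

text \<open>On vectors of positive norm, taking the coroot twice gives back the vector.\<close>

lemma coroot_inject:
  assumes "coroot B \<beta> = coroot B \<gamma>" "0 < B \<beta> \<beta>" "0 < B \<gamma> \<gamma>" shows "\<beta> = \<gamma>"
proof -
  have "\<delta> = (2 / B (coroot B \<delta>) (coroot B \<delta>)) *\<^sub>R coroot B \<delta>" if "0 < B \<delta> \<delta>" for \<delta>
    using that bilinear by (simp add: coroot_def bilinear_lmul bilinear_rmul)
  then show ?thesis
    using assms by metis
qed

text \<open>By primitivity of both coroots, \<open>c\<close> and its inverse are integers, hence
  \<open>c\<close> is 1 or -1.\<close>

lemma proportional_coroots:
  assumes \<beta>: "\<beta> \<in> real_roots B \<alpha> r" and \<gamma>: "\<gamma> \<in> real_roots B \<alpha> r"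
    and eq: "coroot B \<beta> = c *\<^sub>R coroot B \<gamma>"
  shows "\<beta> = \<gamma> \<or> \<beta> = - \<gamma>"
proof -
  note pos = root_norm_pos[OF \<beta>] root_norm_pos[OF \<gamma>]
  have "coroot B \<beta> \<noteq> 0"
    using pos bilinear by (auto simp: coroot_def bilinear_lzero)
  then have "c \<noteq> 0"
    using eq by auto
  then have "inverse c *\<^sub>R coroot B \<beta> = coroot B \<gamma>"
    using eq by simp
  then have "inverse c \<in> \<int>"
    using scale_coroot_in_lattice_imp_Ints[OF \<beta>] coroot_in_lattice[OF \<gamma>] by simp
  moreover have "c \<in> \<int>"
    using scale_coroot_in_lattice_imp_Ints[OF \<gamma>] coroot_in_lattice[OF \<beta>] eq by simp
  ultimately obtain m n :: int where mn: "c = of_int m" "inverse c = of_int n"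
    by (auto elim!: Ints_cases)
  then have "of_int (m * n) = (1 :: real)"
    using \<open>c \<noteq> 0\<close> by (metis of_int_mult right_inverse)
  then have "m * n = 1"
    by linarith
  then have "c = 1 \<or> c = -1"
    using mn(1) by (auto simp: zmult_eq_1_iff)
  then have "coroot B \<beta> = coroot B \<gamma> \<or> coroot B \<beta> = coroot B (- \<gamma>)"
    using eq by (auto simp: coroot_uminus)
  moreover have "0 < B (- \<gamma>) (- \<gamma>)"
    using pos(2) bilinear by (simp add: bilinear_lneg bilinear_rneg)
  ultimately show ?thesis
    using coroot_inject pos by blast
qed

lemma proportional_positive_coroots:
  assumes "\<beta> \<in> positive_roots B \<alpha> r" "\<gamma> \<in> positive_roots B \<alpha> r"
    and "coroot B \<beta> = c *\<^sub>R coroot B \<gamma>"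
  shows "\<beta> = \<gamma>"
  using proportional_coroots[OF _ _ assms(3)] assms(1,2) pos_neg_disjoint
  by (auto simp: positive_roots_def)

lemma coroot_in_span:
  assumes "\<beta> \<in> real_roots B \<alpha> r" shows "coroot B \<beta> \<in> span (\<alpha> ` {1..r})"
proof -
  obtain n where n: "coroot B \<beta> = (\<Sum>p=1..r. of_int (n p) *\<^sub>R coroot B (\<alpha> p))"
    using coroot_in_lattice[OF assms] by (rule coroot_latticeE)
  show ?thesis
    unfolding n unfolding coroot_def by (intro span_sum span_scale span_base imageI)
qed

end

section \<open>The index set and its total order\<close>

locale dominant_weight = kac_moody_roots B \<alpha> r + positive_cone P
  for B :: "'v::real_vector \<Rightarrow> 'v \<Rightarrow> real" and \<alpha> r and P +
  fixes \<mu> :: 'v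
  assumes simple_cone: "p \<in> {1..r} \<Longrightarrow> P (\<alpha> p)"
    and cone_total: "v \<in> span (\<alpha> ` {1..r}) \<Longrightarrow> v \<noteq> 0 \<Longrightarrow> P v \<or> P (- v)"
    and integral: "\<mu> \<in> integral_weights B \<alpha> r"
    and dominant: "dominant B \<alpha> r \<mu>"
begin

abbreviation level :: "'v \<Rightarrow> real" where "level \<beta> \<equiv> B \<mu> (coroot B \<beta>)"

text \<open>Ties between the ratios are broken by the cone order on coroots divided by their levels.
  Roots of level zero, where division returns 0, do not occur in \<open>index_set\<close>, since
  \<open>k < level \<beta>\<close> forces a positive level.\<close>

definition less :: "'v \<times> nat \<Rightarrow> 'v \<times> nat \<Rightarrow> bool" where
  "less = (\<lambda>(\<beta>, k) (\<gamma>, m). k / level \<beta> < m / level \<gamma> \<or>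
     k / level \<beta> = m / level \<gamma> \<and> P ((1 / level \<gamma>) *\<^sub>R coroot B \<gamma> - (1 / level \<beta>) *\<^sub>R coroot B \<beta>))"

definition index_set :: "('v \<times> nat) set" where
  "index_set = {(\<beta>, k). \<beta> \<in> positive_roots B \<alpha> r \<and> k < level \<beta>}"

definition index_order :: "('v \<times> nat) rel" where
  "index_order = {(i, j). i \<in> index_set \<and> j \<in> index_set \<and> (i = j \<or> less i j)}"

lemma less_irrefl: "\<not> less i i"
  using nonzero by (auto simp: less_def)

text \<open>When all ratios tie, the two differences of scaled coroots telescope.\<close>

lemma less_trans: "less i j \<Longrightarrow> less j l \<Longrightarrow> less i l"
  unfolding less_def by (force split: prod.splits dest: add)

lemma positive_root_real: "\<beta> \<in> positive_roots B \<alpha> r \<Longrightarrow> \<beta> \<in> real_roots B \<alpha> r"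
  by (simp add: positive_roots_def)

lemma linear_order_index: "linear_order_on index_set index_order"
proof -
  have total: "less i j \<or> less j i" if "i \<in> index_set" "j \<in> index_set" "i \<noteq> j" for i j
  proof -
    obtain \<beta> k \<gamma> m where ij: "i = (\<beta>, k)" "j = (\<gamma>, m)"
      by (metis surj_pair)
    have \<beta>: "\<beta> \<in> positive_roots B \<alpha> r" "k < level \<beta>" and \<gamma>: "\<gamma> \<in> positive_roots B \<alpha> r" "m < level \<gamma>"
      using that by (auto simp: index_set_def ij)
    then have pos: "0 < level \<beta>" "0 < level \<gamma>"
      by linarith+
    define d where "d = (1 / level \<gamma>) *\<^sub>R coroot B \<gamma> - (1 / level \<beta>) *\<^sub>R coroot B \<beta>"
    \<comment> \<open>If ratios and scaled coroots both agreed, the coroots would be proportional;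
      then the roots coincide, and so do \<open>k\<close> and \<open>m\<close>. Hence a tie has
      \<open>d\<close> nonzero and the cone decides it.\<close>
    have "k / level \<beta> \<noteq> m / level \<gamma> \<or> d \<noteq> 0"
    proof (rule ccontr)
      assume "\<not> ?thesis"
      then have eq: "k / level \<beta> = m / level \<gamma>" "(1 / level \<beta>) *\<^sub>R coroot B \<beta> = (1 / level \<gamma>) *\<^sub>R coroot B \<gamma>"
        by (simp_all add: d_def)
      then have "level \<beta> *\<^sub>R (1 / level \<beta>) *\<^sub>R coroot B \<beta> = level \<beta> *\<^sub>R (1 / level \<gamma>) *\<^sub>R coroot B \<gamma>"
        by simp
      then have "coroot B \<beta> = (level \<beta> / level \<gamma>) *\<^sub>R coroot B \<gamma>"
        using pos by simp
      then have "\<beta> = \<gamma>"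
        using proportional_positive_coroots \<beta>(1) \<gamma>(1) by blast
      with eq(1) pos that(3) show False
        by (simp add: ij)
    qed
    moreover have "d \<in> span (\<alpha> ` {1..r})"
      unfolding d_def using \<beta> \<gamma> positive_root_real
      by (intro span_diff span_scale coroot_in_span) auto
    moreover have "- d = (1 / level \<beta>) *\<^sub>R coroot B \<beta> - (1 / level \<gamma>) *\<^sub>R coroot B \<gamma>"
      by (simp add: d_def)
    ultimately show ?thesis
      using cone_total[of d] unfolding less_def ij by (auto simp: d_def)
  qed
  show ?thesis
    unfolding linear_order_on_def partial_order_on_def preorder_on_def
  proof (intro conjI)
    show "refl_on index_set index_order"
      by (auto simp: refl_on_def index_order_def)
    show "index_order \<subseteq> index_set \<times> index_set"
      by (auto simp: index_order_def)
    show "trans index_order"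
      unfolding trans_def index_order_def mem_Collect_eq case_prod_conv using less_trans by metis
    show "antisym index_order"
      unfolding antisym_def index_order_def mem_Collect_eq case_prod_conv
      using less_trans less_irrefl by metis
    show "total_on index_set index_order"
      unfolding total_on_def index_order_def mem_Collect_eq case_prod_conv using total by metis
  qed
qed

section \<open>Counting the predecessors of an index\<close>

lemma coroot_positive:
  assumes "\<beta> \<in> positive_roots B \<alpha> r" shows "P (coroot B \<beta>)"
proof -
  obtain c where "\<forall>p\<in>{1..r}. 0 \<le> c p" "\<beta> = (\<Sum>p=1..r. c p *\<^sub>R \<alpha> p)"
    using assms unfolding positive_roots_def by blast
  then have "\<beta> = 0 \<or> P \<beta>"
    using nonneg_sum[of "{1..r}" \<alpha> c] simple_cone by auto
  moreover have "0 < B \<beta> \<beta>"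
    using assms by (intro root_norm_pos positive_root_real)
  ultimately show ?thesis
    using bilinear by (auto simp: coroot_def bilinear_lzero intro: scale)
qed

text \<open>Integrality and dominance of \<mu> enter here.\<close>

lemma level_nat:
  assumes "\<beta> \<in> positive_roots B \<alpha> r" obtains a :: nat where "level \<beta> = a"
proof -
  have "level \<beta> \<in> \<int>"
    using B_coroot_lattice_Ints[OF coroot_in_lattice[OF positive_root_real[OF assms]]] integral
    by (auto simp: integral_weights_def)
  moreover have "0 \<le> level \<beta>"
    using dominant assms by (auto simp: dominant_def)
  ultimately show thesis
    using that by (metis Ints_cases of_int_0_le_iff of_nat_nat)
qed

text \<open>Defined for all vectors \<open>v\<close>, so that negation and translation by multiples
  of the coroot of \<beta> can be treated without deciding the signs of roots.\<close>

definition generic_count :: "'v \<Rightarrow> nat \<Rightarrow> 'v \<Rightarrow> int" where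
  "generic_count \<beta> m v = \<lceil>B \<mu> v * (m / level \<beta>)\<rceil> +
     (if B \<mu> v * (m / level \<beta>) \<in> \<int> \<and> P (B \<mu> v *\<^sub>R coroot B \<beta> - level \<beta> *\<^sub>R v) then 1 else 0)"

lemma chain_count_positive:
  assumes i: "(\<beta>, m) \<in> index_set" and \<gamma>: "\<gamma> \<in> positive_roots B \<alpha> r"
  shows "chain_count B \<alpha> r index_set index_order fst (\<beta>, m) \<gamma> = generic_count \<beta> m (coroot B \<gamma>)"
proof -
  obtain a :: nat where a: "level \<gamma> = a"
    using level_nat[OF \<gamma>] .
  define b t Q where "b = level \<beta>" and "t = m / b" and "Q = P (a *\<^sub>R coroot B \<beta> - b *\<^sub>R coroot B \<gamma>)"
  have b: "0 < b" and t: "0 \<le> t" "t < 1"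
    using i by (auto simp: index_set_def b_def t_def)
  \<comment> \<open>At level zero the tie vector is a negative multiple of a positive
    coroot.\<close>
  have Q0: "\<not> Q" if "a = 0"
    using asym[OF scale[OF b coroot_positive[OF \<gamma>]]] that by (simp add: Q_def)
  have "less (\<gamma>, k) (\<beta>, m) \<longleftrightarrow> real k < a * t \<or> real k = a * t \<and> Q" if "k < a" for k
  proof -
    have pos: "0 < real a" "0 < a * b"
      using that b by auto
    \<comment> \<open>Clearing denominators by the positive factor \<open>a * b\<close> preserves
      the sign and gives the tie vector of \<open>generic_count\<close>.\<close>
    have "(a * b) *\<^sub>R ((1 / b) *\<^sub>R coroot B \<beta> - (1 / a) *\<^sub>R coroot B \<gamma>) =
        a *\<^sub>R coroot B \<beta> - b *\<^sub>R coroot B \<gamma>"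
      using pos b by (simp add: scaleR_diff_right)
    then have "Q \<longleftrightarrow> P ((1 / b) *\<^sub>R coroot B \<beta> - (1 / a) *\<^sub>R coroot B \<gamma>)"
      unfolding Q_def using scale_iff[OF pos(2)] by metis
    moreover have "real k / a < t \<longleftrightarrow> k < a * t" "real k / a = t \<longleftrightarrow> k = a * t"
      using pos by (auto simp: field_simps)
    ultimately show ?thesis
      by (simp add: less_def a b_def[symmetric] t_def[symmetric])
  qed
  then have "{j \<in> index_set. (j, (\<beta>, m)) \<in> index_order \<and> j \<noteq> (\<beta>, m) \<and> fst j = \<gamma>} =
      Pair \<gamma> ` {k. k < a \<and> (real k < a * t \<or> real k = a * t \<and> Q)}"
    using i \<gamma> t(2) less_irrefl by (auto simp: index_order_def index_set_def a)
  then have "chain_count B \<alpha> r index_set index_order fst (\<beta>, m) \<gamma> =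
      int (card {k. k < a \<and> (real k < a * t \<or> real k = a * t \<and> Q)})"
    using \<gamma> by (simp add: chain_count_def card_image inj_on_def)
  also have "\<dots> = generic_count \<beta> m (coroot B \<gamma>)"
    using card_nat_below[OF t Q0] by (simp add: generic_count_def a b_def t_def Q_def)
  finally show ?thesis .
qed

text \<open>The threshold is \<open>m\<close> itself, and the tie vector is 0, which lies outside
  the cone.\<close>

lemma chain_count_self:
  assumes "(\<beta>, m) \<in> index_set"
  shows "chain_count B \<alpha> r index_set index_order fst (\<beta>, m) \<beta> = m"
proof -
  have "\<beta> \<in> positive_roots B \<alpha> r" "level \<beta> \<noteq> 0"
    using assms by (auto simp: index_set_def)
  then show ?thesis
    using chain_count_positive[OF assms] nonzero by (simp add: generic_count_def)
qed

text \<open>Negating \<open>v\<close> negates the threshold \<open>x\<close> and the tie vector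
  \<open>d\<close>. If \<open>x\<close> is not an integer, the two ceilings sum to 1; if it is, they
  cancel, and exactly one of \<open>d\<close> and \<open>- d\<close> is positive because
  \<open>d\<close> is nonzero.\<close>

lemma generic_count_uminus:
  assumes "v \<in> span (\<alpha> ` {1..r})" "coroot B \<beta> \<in> span (\<alpha> ` {1..r})"
    and ne: "B \<mu> v *\<^sub>R coroot B \<beta> \<noteq> level \<beta> *\<^sub>R v"
  shows "generic_count \<beta> m (- v) = 1 - generic_count \<beta> m v"
proof -
  define x d where "x = B \<mu> v * (m / level \<beta>)" and "d = B \<mu> v *\<^sub>R coroot B \<beta> - level \<beta> *\<^sub>R v"
  have "P d \<or> P (- d)"
    unfolding d_def using assms by (intro cone_total span_diff span_scale) auto
  then have "P (- d) \<longleftrightarrow> \<not> P d"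
    using asym by blast
  moreover have "B \<mu> (- v) *\<^sub>R coroot B \<beta> - level \<beta> *\<^sub>R (- v) = - d" "B \<mu> (- v) * (m / level \<beta>) = - x"
    using bilinear by (simp_all add: d_def x_def bilinear_rneg)
  moreover have "\<lceil>- x\<rceil> = (if x \<in> \<int> then - \<lceil>x\<rceil> else 1 - \<lceil>x\<rceil>)"
  proof (cases "x \<in> \<int>")
    case False
    then have "x \<noteq> of_int \<lfloor>x\<rfloor>"
      by (metis Ints_of_int)
    with False show ?thesis
      by (simp only: ceiling_minus) (simp add: ceiling_altdef)
  qed (auto elim!: Ints_cases simp: ceiling_minus)
  moreover have "generic_count \<beta> m v = \<lceil>x\<rceil> + (if x \<in> \<int> \<and> P d then 1 else 0)"
    by (simp only: generic_count_def x_def d_def)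
  ultimately show ?thesis
    by (simp only: generic_count_def) simp
qed

text \<open>For negative \<gamma> the convention defining the count agrees with
  \<open>generic_count_uminus\<close>; the tie vector is nonzero because \<gamma> is not \<beta> or
  its negative.\<close>

lemma chain_count_generic:
  assumes i: "(\<beta>, m) \<in> index_set" and \<gamma>: "\<gamma> \<in> real_roots B \<alpha> r" and ne: "\<gamma> \<noteq> \<beta>" "\<gamma> \<noteq> - \<beta>"
  shows "chain_count B \<alpha> r index_set index_order fst (\<beta>, m) \<gamma> = generic_count \<beta> m (coroot B \<gamma>)"
proof (cases "\<gamma> \<in> positive_roots B \<alpha> r")
  case False
  have \<beta>: "\<beta> \<in> real_roots B \<alpha> r" and b: "level \<beta> \<noteq> 0"
    using i positive_root_real by (auto simp: index_set_def)
  have neg: "- \<gamma> \<in> positive_roots B \<alpha> r"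
    using False \<gamma> roots_pos_neg by auto
  have "level \<gamma> *\<^sub>R coroot B \<beta> \<noteq> level \<beta> *\<^sub>R coroot B \<gamma>"
  proof
    assume "level \<gamma> *\<^sub>R coroot B \<beta> = level \<beta> *\<^sub>R coroot B \<gamma>"
    then have "inverse (level \<beta>) *\<^sub>R level \<gamma> *\<^sub>R coroot B \<beta> = inverse (level \<beta>) *\<^sub>R level \<beta> *\<^sub>R coroot B \<gamma>"
      by simp
    then have "coroot B \<gamma> = (inverse (level \<beta>) * level \<gamma>) *\<^sub>R coroot B \<beta>"
      using b by simp
    with proportional_coroots[OF \<gamma> \<beta>] ne show False by blast
  qed
  then have "generic_count \<beta> m (- coroot B \<gamma>) = 1 - generic_count \<beta> m (coroot B \<gamma>)"
    using coroot_in_span \<beta> \<gamma> by (intro generic_count_uminus) auto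
  moreover have "chain_count B \<alpha> r index_set index_order fst (\<beta>, m) \<gamma> =
      1 - chain_count B \<alpha> r index_set index_order fst (\<beta>, m) (- \<gamma>)"
    using False neg by (simp add: chain_count_def)
  ultimately show ?thesis
    using chain_count_positive[OF i neg] by (simp add: coroot_uminus)
qed (use chain_count_positive i in auto)

lemma generic_count_add:
  assumes "level \<beta> \<noteq> 0"
  shows "generic_count \<beta> m (v + of_int k *\<^sub>R coroot B \<beta>) = generic_count \<beta> m v + k * m"
proof -
  define u where "u = v + of_int k *\<^sub>R coroot B \<beta>"
  have lev: "B \<mu> u = B \<mu> v + k * level \<beta>"
    using bilinear by (simp add: u_def bilinear_radd bilinear_rmul)
  then have "B \<mu> u * (m / level \<beta>) = B \<mu> v * (m / level \<beta>) + of_int (k * m)"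
    using assms by (simp add: field_simps)
  moreover have "B \<mu> u *\<^sub>R coroot B \<beta> - level \<beta> *\<^sub>R u = B \<mu> v *\<^sub>R coroot B \<beta> - level \<beta> *\<^sub>R v"
    unfolding lev by (simp add: u_def algebra_simps)
  moreover have "x + of_int z \<in> \<int> \<longleftrightarrow> x \<in> \<int>" for x :: real and z
    by (metis Ints_add Ints_diff Ints_of_int add_diff_cancel_right')
  ultimately show ?thesis
    unfolding u_def[symmetric] generic_count_def by (simp only: ceiling_add_of_int)
qed

section \<open>Verification of the chain conditions\<close>

theorem lambda_chain_index: "lambda_chain B \<alpha> r \<mu> index_set index_order fst"
  unfolding lambda_chain_def
proof (intro conjI ballI allI impI)
  show "linear_order_on index_set index_order"
    by (rule linear_order_index)
  show "fst ` index_set \<subseteq> positive_roots B \<alpha> r"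
    by (auto simp: index_set_def)
next
  fix \<gamma> assume \<gamma>: "\<gamma> \<in> positive_roots B \<alpha> r"
  then obtain a :: nat where a: "level \<gamma> = a"
    by (rule level_nat)
  have "{i \<in> index_set. fst i = \<gamma>} = Pair \<gamma> ` {..<a}"
    using \<gamma> a by (auto simp: index_set_def)
  then show "finite {i \<in> index_set. fst i = \<gamma>}" "card {i \<in> index_set. fst i = \<gamma>} = level \<gamma>"
    by (simp_all add: card_image inj_on_def a)
next
  fix \<gamma>\<^sub>1 \<gamma>\<^sub>2 \<gamma>\<^sub>3 :: 'v and k :: int and i :: "'v \<times> nat"
  assume roots: "\<gamma>\<^sub>1 \<in> real_roots B \<alpha> r" "\<gamma>\<^sub>2 \<in> real_roots B \<alpha> r" "\<gamma>\<^sub>3 \<in> real_roots B \<alpha> r"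
    and i: "i \<in> index_set" "fst i = \<gamma>\<^sub>2" and ne: "\<gamma>\<^sub>1 \<noteq> \<gamma>\<^sub>2" "\<gamma>\<^sub>1 \<noteq> - \<gamma>\<^sub>2"
    and eq: "coroot B \<gamma>\<^sub>3 = coroot B \<gamma>\<^sub>1 + of_int k *\<^sub>R coroot B \<gamma>\<^sub>2"
  obtain m where m: "i = (\<gamma>\<^sub>2, m)"
    using i(2) by (cases i) auto
  have lev: "level \<gamma>\<^sub>2 \<noteq> 0"
    using i(1) by (auto simp: index_set_def m)
  \<comment> \<open>The generic formula requires \<open>\<gamma>\<^sub>3\<close> to differ from
    \<open>\<gamma>\<^sub>2\<close> and its negative; otherwise the coroot of
    \<open>\<gamma>\<^sub>1\<close> would also be a multiple of that of
    \<open>\<gamma>\<^sub>2\<close>.\<close>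
  have "\<gamma>\<^sub>3 \<noteq> c *\<^sub>R \<gamma>\<^sub>2" if "c = 1 \<or> c = -1" for c
  proof
    assume "\<gamma>\<^sub>3 = c *\<^sub>R \<gamma>\<^sub>2"
    then have "coroot B \<gamma>\<^sub>3 = c *\<^sub>R coroot B \<gamma>\<^sub>2"
      using that coroot_uminus[of \<gamma>\<^sub>2] by auto
    then have "coroot B \<gamma>\<^sub>1 = (c - of_int k) *\<^sub>R coroot B \<gamma>\<^sub>2"
      using eq by (simp add: algebra_simps)
    with proportional_coroots[OF roots(1,2)] ne show False by blast
  qed
  from this[of 1] this[of "-1"] have "\<gamma>\<^sub>3 \<noteq> \<gamma>\<^sub>2" "\<gamma>\<^sub>3 \<noteq> - \<gamma>\<^sub>2"
    by auto
  then show "chain_count B \<alpha> r index_set index_order fst i \<gamma>\<^sub>3 =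
      chain_count B \<alpha> r index_set index_order fst i \<gamma>\<^sub>1 +
      k * chain_count B \<alpha> r index_set index_order fst i \<gamma>\<^sub>2"
    using i(1) roots ne lev unfolding m
    by (simp add: chain_count_self chain_count_generic eq generic_count_add)
qed

end

theorem lemma1p1:
  fixes B :: "'v::real_vector \<Rightarrow> 'v \<Rightarrow> real" and \<alpha> :: "nat \<Rightarrow> 'v" and r :: nat and \<mu> :: 'v
  assumes "kac_moody_roots B \<alpha> r"
    and "\<mu> \<in> integral_weights B \<alpha> r"
    and "dominant B \<alpha> r \<mu>"
  shows "\<exists>(I :: ('v \<times> nat) set) R \<beta>. lambda_chain B \<alpha> r \<mu> I R \<beta>"
proof -
  interpret kac_moody_roots B \<alpha> r by (rule assms(1))
  obtain P where "positive_cone P" "\<And>p. p \<in> {1..r} \<Longrightarrow> P (\<alpha> p)"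
    "\<And>v. v \<in> span (\<alpha> ` {1..r}) \<Longrightarrow> v \<noteq> 0 \<Longrightarrow> P v \<or> P (- v)"
    using ex_lex_cone[OF simple_independent simple_inj] by blast
  then interpret dominant_weight B \<alpha> r P \<mu>
    using assms by (simp add: dominant_weight_def dominant_weight_axioms_def)
  show ?thesis
    using lambda_chain_index by blast
qed

end
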